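(* Let $\mathcal{T}$ be an ultrametric tree with node set $V$, root $\mathsf{r}$, leaf nodes $L$ and height function $h:V\to\mathbb{R}_+$ inducing the tree metric $d_{\mathcal{T}}$. For any $p\ge1$, any $C>0$ and any two non-negative measures $\mu^L,\nu^L\in\mathcal{M}_+(L)$ supported on the leaf nodes of $\mathcal{T}$, it holds that $$\mathrm{KR}^p_{p,C}(\mu^L,\nu^L)=\sum_{\mathsf{v}\in\mathcal{R}(C)}\Bigg(2^{p-1}\sum_{\mathsf{w}\in\mathcal{C}(\mathsf{v})\setminus\{\mathsf{v}\}}\big(h(\mathrm{par}(\mathsf{w}))^p-h(\mathsf{w})^p\big)\,\big|\mu^L(\mathcal{C}(\mathsf{w}))-\nu^L(\mathcal{C}(\mathsf{w}))\big|+\Big(\frac{C^p}{2}-2^{p-1}h(\mathsf{v})^p\Big)\big|\mu^L(\mathcal{C}(\mathsf{v}))-\nu^L(\mathcal{C}(\mathsf{v}))\big|\Bigg).$$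
   Context: Trees: $\mathcal{T}$ is a finite tree with nodes $V$, edges with non-negative weights, and a designated root $\mathsf{r}$. $\mathcal{P}(\mathsf{v},\mathsf{w})$ is the unique path between two nodes, and $d_{\mathcal{T}}(\mathsf{v},\mathsf{w})$ is the sum of the weights of its edges. A leaf is a node of degree one; $L\subset V$ is the set of leaves. The parent $\mathrm{par}(\mathsf{v})$ is the node adjacent to $\mathsf{v}$ that is closer to the root, with $\mathrm{par}(\mathsf{r})=\mathsf{r}$. The set of children of $\mathsf{v}$ is $\mathcal{C}(\mathsf{v})=\{\mathsf{w}\in V:\mathsf{v}\in\mathcal{P}(\mathsf{w},\mathsf{r})\}$ (so $\mathsf{v}\in\mathcal{C}(\mathsf{v})$). The tree is ultrametric if all leaves are at the same distance to the root; equivalently there is a height function $h:V\to\mathbb{R}_+$ with $h(\mathrm{par}(\mathsf{v}))\ge h(\mathsf{v})$ for all $\mathsf{v}$, $h(\mathsf{v})=0$ for $\mathsf{v}\in L$, and $d_{\mathcal{T}}(\mathsf{v},\mathrm{par}(\mathsf{v}))=|h(\mathsf{v})-h(\mathrm{par}(\mathsf{v}))|$ (extended to the full tree along paths). Define $\mathcal{R}(C)=\{\mathsf{v}\in V: h(\mathsf{v})\le\frac{C}{2}<h(\mathrm{par}(\mathsf{v}))\}$, with the convention $\mathcal{R}(C)=\{\mathsf{r}\}$ if $C/2\ge h(\mathsf{r})$, and $\mu^L(\mathcal{C}(\mathsf{v}))=\sum_{\mathsf{w}\in\mathcal{C}(\mathsf{v})\cap L}\mu^L(\mathsf{w})$.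 Kantorovich-Rubinstein distance: for non-negative measures $\mu,\nu$ on a finite space $(\mathcal{X},d)$ with total masses $\mathbb{M}(\mu)=\sum_x\mu(x)$, $\mathbb{M}(\nu)$, $$\mathrm{KR}_{p,C}^p(\mu,\nu)=\min_{\pi}\ \sum_{x,x'}d^p(x,x')\pi(x,x')+C^p\left(\frac{\mathbb{M}(\mu)+\mathbb{M}(\nu)}{2}-\mathbb{M}(\pi)\right),$$ where the minimum is over non-negative measures $\pi$ on $\mathcal{X}\times\mathcal{X}$ with $\sum_{x'}\pi(x,x')\le\mu(x)$ and $\sum_{x}\pi(x,x')\le\nu(x')$ for all $x,x'$. Here it is used with $\mathcal{X}=L$ and $d=d_{\mathcal{T}}$. *)

theory Defs
  imports "HOL-Analysis.Analysis" "Graph_Theory.Pair_Digraph" "Graph_Theory.Weighted_Graph"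
begin

section \<open>Kantorovich-Rubinstein distance on a finite space\<close>

text \<open>A measure on a finite set X is given by its point masses; values off X are never used.\<close>

definition nonneg_measures :: "'a set \<Rightarrow> ('a \<Rightarrow> real) set" where
  "nonneg_measures X = {\<mu>. \<forall>x\<in>X. 0 \<le> \<mu> x}"

definition total_mass :: "'a set \<Rightarrow> ('a \<Rightarrow> real) \<Rightarrow> real" where
  "total_mass X \<mu> = (\<Sum>x\<in>X. \<mu> x)"

definition sub_couplings :: "'a set \<Rightarrow> ('a \<Rightarrow> real) \<Rightarrow> ('a \<Rightarrow> real) \<Rightarrow> ('a \<times> 'a \<Rightarrow> real) set" where
  "sub_couplings X \<mu> \<nu> =
    {\<pi> \<in> nonneg_measures (X \<times> X).
       (\<forall>x\<in>X. (\<Sum>x'\<in>X. \<pi> (x, x')) \<le> \<mu> x) \<and>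
       (\<forall>x'\<in>X. (\<Sum>x\<in>X. \<pi> (x, x')) \<le> \<nu> x')}"

definition KR_cost ::
  "real \<Rightarrow> real \<Rightarrow> 'a set \<Rightarrow> ('a \<Rightarrow> 'a \<Rightarrow> real) \<Rightarrow> ('a \<Rightarrow> real) \<Rightarrow> ('a \<Rightarrow> real) \<Rightarrow> ('a \<times> 'a \<Rightarrow> real) \<Rightarrow> real"
where
  "KR_cost p C X d \<mu> \<nu> \<pi> =
    (\<Sum>(x, x')\<in>X \<times> X. d x x' powr p * \<pi> (x, x')) +
    C powr p * ((total_mass X \<mu> + total_mass X \<nu>) / 2 - total_mass (X \<times> X) \<pi>)"

text \<open>LEAST is a genuine minimum: its value is determined only if the minimum is attained.\<close>

definition KR ::
  "real \<Rightarrow> real \<Rightarrow> 'a set \<Rightarrow> ('a \<Rightarrow> 'a \<Rightarrow> real) \<Rightarrow> ('a \<Rightarrow> real) \<Rightarrow> ('a \<Rightarrow> real) \<Rightarrow> real"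
where
  "KR p C X d \<mu> \<nu> =
    (LEAST c. c \<in> KR_cost p C X d \<mu> \<nu> ` sub_couplings X \<mu> \<nu>) powr (1 / p)"


section \<open>Weighted rooted trees\<close>

text \<open>
  An undirected graph is a symmetric digraph. The constant tree of Graph\_Theory does not apply
  to such graphs, because there u, v, u counts as a cycle for every edge uv.
\<close>

definition tree_path :: "'a pair_pre_digraph \<Rightarrow> 'a \<Rightarrow> 'a \<Rightarrow> ('a \<times> 'a) awalk" where
  "tree_path T u v = (THE q. pre_digraph.apath (with_proj T) u q v)"

definition path_nodes :: "'a pair_pre_digraph \<Rightarrow> 'a \<Rightarrow> 'a \<Rightarrow> 'a set" where
  "path_nodes T u v = set (pre_digraph.awalk_verts (with_proj T) u (tree_path T u v))"

definition tree_dist :: "'a pair_pre_digraph \<Rightarrow> ('a \<times> 'a) weight_fun \<Rightarrow> 'a \<Rightarrow> 'a \<Rightarrow> real" where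
  "tree_dist T wt u v = wf_digraph.awalk_cost wt (tree_path T u v)"

definition leaves :: "'a pair_pre_digraph \<Rightarrow> 'a set" where
  "leaves T = {v \<in> pverts T. out_degree (with_proj T) v = 1}"

text \<open>
  Closeness to the root is measured by the number of edges, as edges may have weight zero.
\<close>

definition parent :: "'a pair_pre_digraph \<Rightarrow> 'a \<Rightarrow> 'a \<Rightarrow> 'a" where
  "parent T r v =
    (if v = r then r
     else (THE u. (v, u) \<in> parcs T \<and> length (tree_path T u r) < length (tree_path T v r)))"

text \<open>All descendants of v, including v itself.\<close>

definition children :: "'a pair_pre_digraph \<Rightarrow> 'a \<Rightarrow> 'a \<Rightarrow> 'a set" where
  "children T r v = {w \<in> pverts T. v \<in> path_nodes T w r}"

definition subtree_mass :: "'a pair_pre_digraph \<Rightarrow> 'a \<Rightarrow> ('a \<Rightarrow> real) \<Rightarrow> 'a \<Rightarrow> real" where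
  "subtree_mass T r \<mu> v = (\<Sum>w\<in>children T r v \<inter> leaves T. \<mu> w)"

definition cut_nodes :: "'a pair_pre_digraph \<Rightarrow> 'a \<Rightarrow> ('a \<Rightarrow> real) \<Rightarrow> real \<Rightarrow> 'a set" where
  "cut_nodes T r h C =
    (if h r \<le> C / 2 then {r}
     else {v \<in> pverts T. h v \<le> C / 2 \<and> C / 2 < h (parent T r v)})"

locale weighted_rooted_tree = pair_graph T
  for T :: "'a pair_pre_digraph" +
  fixes wt :: "('a \<times> 'a) weight_fun" and r :: 'a
  assumes unique_path: "\<lbrakk>u \<in> pverts T; v \<in> pverts T\<rbrakk> \<Longrightarrow> \<exists>!q. apath u q v"
    and root_in_verts: "r \<in> pverts T"
    and weight_nonneg: "e \<in> parcs T \<Longrightarrow> 0 \<le> wt e"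
    and weight_sym: "(u, v) \<in> parcs T \<Longrightarrow> wt (u, v) = wt (v, u)"

locale ultrametric_tree = weighted_rooted_tree T wt r
  for T :: "'a pair_pre_digraph" and wt :: "('a \<times> 'a) weight_fun" and r :: 'a +
  assumes leaves_equidistant:
    "\<lbrakk>u \<in> leaves T; v \<in> leaves T\<rbrakk> \<Longrightarrow> tree_dist T wt u r = tree_dist T wt v r"

locale ultrametric_tree_height = ultrametric_tree T wt r
  for T :: "'a pair_pre_digraph" and wt :: "('a \<times> 'a) weight_fun" and r :: 'a +
  fixes h :: "'a \<Rightarrow> real"
  assumes height_nonneg: "v \<in> pverts T \<Longrightarrow> 0 \<le> h v"
    and height_parent: "v \<in> pverts T \<Longrightarrow> h v \<le> h (parent T r v)"
    and height_leaf: "v \<in> leaves T \<Longrightarrow> h v = 0"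
    and height_dist:
      "v \<in> pverts T \<Longrightarrow> tree_dist T wt v (parent T r v) = \<bar>h v - h (parent T r v)\<bar>"

end

theory Submission
  imports Defs
begin

text \<open>
  Give the nodes w of height at most C/2 weights c(w) \<ge> 0 such that the weights above a leaf
  sum to C^p/2, and let \<sigma>(x, y) be the sum of c(w) over the common ancestors w of the leaves
  x and y. Then C^p - 2 \<sigma>(x, y) is at most d(x, y)^p, with equality if x and y lie below the
  same cut node. Writing C^p/2 for a single leaf as a sum of weights, too, the cost of a sub-coupling
  \<pi> is therefore at least the sum over w of
    c(w) (\<mu>(A) + \<nu>(A) - 2 \<pi>(A \<times> A)),  where A is the set of leaves below w.
  Since \<pi>(A \<times> A) \<le> min (\<mu>(A)) (\<nu>(A)), this is at least the sum of the
  c(w) |\<mu>(A) - \<nu>(A)|, which is the claimed value. As the sets A form a laminar family,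
  a bottom-up greedy matching turns all these inequalities into equalities at once.
\<close>

section \<open>Partial transport along a laminar family\<close>

lemma sub_couplings_nonneg:
  "\<pi> \<in> sub_couplings X \<mu> \<nu> \<Longrightarrow> x \<in> X \<Longrightarrow> y \<in> X \<Longrightarrow> 0 \<le> \<pi> (x, y)"
  by (auto simp: sub_couplings_def nonneg_measures_def)

text \<open>Mass that stays inside W is counted by the rows over W, which \<mu> bounds, and by the
  columns over W, which \<nu> bounds.\<close>

lemma sub_coupling_square_le_min:
  assumes \<pi>: "\<pi> \<in> sub_couplings X \<mu> \<nu>" and "finite X" and "W \<subseteq> X"
  shows "sum \<pi> (W \<times> W) \<le> min (sum \<mu> W) (sum \<nu> W)"
proof -
  have "sum \<pi> (W \<times> W) = (\<Sum>x\<in>W. \<Sum>y\<in>W. \<pi> (x, y))"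
    by (simp add: sum.cartesian_product)
  also have "\<dots> \<le> (\<Sum>x\<in>W. \<Sum>y\<in>X. \<pi> (x, y))"
    using assms sub_couplings_nonneg[OF \<pi>] by (intro sum_mono sum_mono2) auto
  also have "\<dots> \<le> sum \<mu> W"
    using assms by (intro sum_mono) (auto simp: sub_couplings_def)
  finally have 1: "sum \<pi> (W \<times> W) \<le> sum \<mu> W" .
  have "sum \<pi> (W \<times> W) = (\<Sum>y\<in>W. \<Sum>x\<in>W. \<pi> (x, y))"
    by (subst sum.swap) (simp add: sum.cartesian_product)
  also have "\<dots> \<le> (\<Sum>y\<in>W. \<Sum>x\<in>X. \<pi> (x, y))"
    using assms sub_couplings_nonneg[OF \<pi>] by (intro sum_mono sum_mono2) auto
  also have "\<dots> \<le> sum \<nu> W"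
    using assms by (intro sum_mono) (auto simp: sub_couplings_def)
  finally show ?thesis using 1 by simp
qed

text \<open>Greedy matching: move as much mass as possible between two points of a minimal set that still
  carries both measures. Each step exhausts a point of one of the two supports.\<close>

lemma laminar_coupling_ge:
  fixes \<mu> \<nu> :: "'a \<Rightarrow> real"
  assumes "finite X" and "\<And>W. W \<in> F \<Longrightarrow> W \<subseteq> X"
    and laminar: "\<And>W W'. W \<in> F \<Longrightarrow> W' \<in> F \<Longrightarrow> W \<inter> W' = {} \<or> W \<subseteq> W' \<or> W' \<subseteq> W"
    and "\<And>x. x \<in> X \<Longrightarrow> 0 \<le> \<mu> x" and "\<And>x. x \<in> X \<Longrightarrow> 0 \<le> \<nu> x"
  shows "\<exists>\<pi>\<in>sub_couplings X \<mu> \<nu>.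
    (\<forall>W\<in>F. min (sum \<mu> W) (sum \<nu> W) \<le> sum \<pi> (W \<times> W)) \<and>
    (\<forall>x y. \<pi> (x, y) \<noteq> 0 \<longrightarrow> (\<exists>W\<in>F. x \<in> W \<and> y \<in> W))"
  using assms(4,5)
proof (induction "card {x\<in>X. \<mu> x > 0} + card {x\<in>X. \<nu> x > 0}" arbitrary: \<mu> \<nu> rule: less_induct)
  case less
  have finF: "finite F"
    using assms(1,2) by (meson Pow_iff finite_Pow_iff finite_subset subsetI)
  define G where "G = {W\<in>F. (\<exists>x\<in>W. \<mu> x > 0) \<and> (\<exists>y\<in>W. \<nu> y > 0)}"
  show ?case
  \<comment> \<open>If G is empty, every member of F misses the support of \<mu> or that of \<nu>,
    so all minima are 0 and the zero coupling will do.\<close>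
  proof (cases "G = {}")
    case True
    have "min (sum \<mu> W) (sum \<nu> W) \<le> 0" if "W \<in> F" for W
    proof -
      from True that have "(\<forall>x\<in>W. \<mu> x \<le> 0) \<or> (\<forall>y\<in>W. \<nu> y \<le> 0)"
        by (force simp: G_def)
      then show ?thesis
        by (metis min.coboundedI1 min.coboundedI2 sum_nonpos)
    qed
    then show ?thesis
      using less.prems
      by (intro bexI[of _ "\<lambda>_. 0"]) (auto simp: sub_couplings_def nonneg_measures_def)
  next
    case False
    have "finite G" using finF by (simp add: G_def)
    \<comment> \<open>Minimality protects the members of F that contain only one of the two points
      chosen in W: by laminarity such a member lies strictly inside W, hence outside G, and its
      minimum is already 0.\<close>
    then obtain W where W: "W \<in> G" and minimal: "\<And>W'. W' \<in> G \<Longrightarrow> W' \<subseteq> W \<Longrightarrow> W = W'"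
      using False finite_has_minimal[of G] by metis
    obtain x y where xy: "x \<in> W" "\<mu> x > 0" "y \<in> W" "\<nu> y > 0" using W by (auto simp: G_def)
    have WF: "W \<in> F" "W \<subseteq> X" using W assms(2) by (auto simp: G_def)
    define t where "t = min (\<mu> x) (\<nu> y)"
    define \<mu>' where "\<mu>' = (\<lambda>z. \<mu> z - (if z = x then t else 0))"
    define \<nu>' where "\<nu>' = (\<lambda>z. \<nu> z - (if z = y then t else 0))"
    have t: "t > 0" "t \<le> \<mu> x" "t \<le> \<nu> y" using xy by (auto simp: t_def)
    have nn: "\<And>z. z \<in> X \<Longrightarrow> 0 \<le> \<mu>' z" "\<And>z. z \<in> X \<Longrightarrow> 0 \<le> \<nu>' z"
      using less.prems t by (auto simp: \<mu>'_def \<nu>'_def)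
    have sub: "{z\<in>X. \<mu>' z > 0} \<subseteq> {z\<in>X. \<mu> z > 0}" "{z\<in>X. \<nu>' z > 0} \<subseteq> {z\<in>X. \<nu> z > 0}"
      using t by (auto simp: \<mu>'_def \<nu>'_def split: if_splits)
    have "x \<notin> {z\<in>X. \<mu>' z > 0} \<or> y \<notin> {z\<in>X. \<nu>' z > 0}"
      by (auto simp: \<mu>'_def \<nu>'_def t_def)
    then have "{z\<in>X. \<mu>' z > 0} \<subset> {z\<in>X. \<mu> z > 0} \<or> {z\<in>X. \<nu>' z > 0} \<subset> {z\<in>X. \<nu> z > 0}"
      using sub xy WF by blast
    then have "card {z\<in>X. \<mu>' z > 0} + card {z\<in>X. \<nu>' z > 0}
        < card {z\<in>X. \<mu> z > 0} + card {z\<in>X. \<nu> z > 0}"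
    proof
      assume "{z\<in>X. \<mu>' z > 0} \<subset> {z\<in>X. \<mu> z > 0}"
      then show ?thesis
        using sub(2) \<open>finite X\<close> by (intro add_less_le_mono psubset_card_mono card_mono) simp_all
    next
      assume "{z\<in>X. \<nu>' z > 0} \<subset> {z\<in>X. \<nu> z > 0}"
      then show ?thesis
        using sub(1) \<open>finite X\<close> by (intro add_le_less_mono psubset_card_mono card_mono) simp_all
    qed
    from less.hyps[OF this nn] obtain \<pi>' where \<pi>': "\<pi>' \<in> sub_couplings X \<mu>' \<nu>'"
      and ge: "\<And>W. W \<in> F \<Longrightarrow> min (sum \<mu>' W) (sum \<nu>' W) \<le> sum \<pi>' (W \<times> W)"
      and supp: "\<And>x y. \<pi>' (x, y) \<noteq> 0 \<Longrightarrow> \<exists>W\<in>F. x \<in> W \<and> y \<in> W"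
      by blast
    define \<pi> where "\<pi> = (\<lambda>z. \<pi>' z + (if z = (x, y) then t else 0))"
    have fin: "finite W'" if "W' \<in> F" for W'
      using assms(1,2) that finite_subset by blast
    have sum\<mu>: "sum \<mu>' W' = sum \<mu> W' - (if x \<in> W' then t else 0)"
      and sum\<nu>: "sum \<nu>' W' = sum \<nu> W' - (if y \<in> W' then t else 0)"
      and sum\<pi>: "sum \<pi> (W' \<times> W') = sum \<pi>' (W' \<times> W') + (if x \<in> W' \<and> y \<in> W' then t else 0)"
      if "W' \<in> F" for W'
      using fin[OF that] by (simp_all add: \<mu>'_def \<nu>'_def \<pi>_def sum_subtractf sum.distrib)
    have "min (sum \<mu> W') (sum \<nu> W') \<le> sum \<pi> (W' \<times> W')" if W': "W' \<in> F" for W'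
    \<comment> \<open>If W' contains both x and y, or neither, the minimum and the transported mass
      change by the same amount.\<close>
    proof (cases "(x \<in> W' \<and> y \<in> W') \<or> (x \<notin> W' \<and> y \<notin> W')")
      case True
      then show ?thesis
        using ge[OF W'] by (auto simp: sum\<mu>[OF W'] sum\<nu>[OF W'] sum\<pi>[OF W'])
    next
      case False
      then have "W' \<subset> W" using laminar[OF W' \<open>W \<in> F\<close>] xy by blast
      then have "W' \<notin> G" using minimal by blast
      then have "(\<forall>x\<in>W'. \<mu> x \<le> 0) \<or> (\<forall>y\<in>W'. \<nu> y \<le> 0)"
        using W' by (force simp: G_def)
      then have "min (sum \<mu> W') (sum \<nu> W') \<le> 0"
        by (metis min.coboundedI1 min.coboundedI2 sum_nonpos)
      also have "0 \<le> sum \<pi>' (W' \<times> W')"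
        using sub_couplings_nonneg[OF \<pi>'] assms(2)[OF W'] by (intro sum_nonneg) auto
      also have "\<dots> \<le> sum \<pi> (W' \<times> W')" using t sum\<pi>[OF W'] by simp
      finally show ?thesis .
    qed
    moreover have "\<pi> \<in> sub_couplings X \<mu> \<nu>"
    proof -
      have "(\<Sum>b\<in>X. \<pi> (a, b)) \<le> \<mu> a" if "a \<in> X" for a
      proof -
        have "(\<Sum>b\<in>X. \<pi> (a, b)) = (\<Sum>b\<in>X. \<pi>' (a, b)) + (if a = x then t else 0)"
          using \<open>finite X\<close> xy WF by (cases "a = x") (auto simp: \<pi>_def sum.distrib)
        also have "(\<Sum>b\<in>X. \<pi>' (a, b)) \<le> \<mu>' a" using \<pi>' that by (auto simp: sub_couplings_def)
        finally show ?thesis by (simp add: \<mu>'_def)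
      qed
      moreover have "(\<Sum>a\<in>X. \<pi> (a, b)) \<le> \<nu> b" if "b \<in> X" for b
      proof -
        have "(\<Sum>a\<in>X. \<pi> (a, b)) = (\<Sum>a\<in>X. \<pi>' (a, b)) + (if b = y then t else 0)"
          using \<open>finite X\<close> xy WF by (cases "b = y") (auto simp: \<pi>_def sum.distrib)
        also have "(\<Sum>a\<in>X. \<pi>' (a, b)) \<le> \<nu>' b" using \<pi>' that by (auto simp: sub_couplings_def)
        finally show ?thesis by (simp add: \<nu>'_def)
      qed
      moreover have "0 \<le> \<pi> (a, b)" if "a \<in> X" "b \<in> X" for a b
        using sub_couplings_nonneg[OF \<pi>' that] t by (simp add: \<pi>_def)
      ultimately show ?thesis by (auto simp: sub_couplings_def nonneg_measures_def)
    qed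
    moreover have "\<exists>W\<in>F. a \<in> W \<and> b \<in> W" if "\<pi> (a, b) \<noteq> 0" for a b
    proof (cases "(a, b) = (x, y)")
      case True then show ?thesis using WF xy by blast
    next
      case False then show ?thesis using that supp by (auto simp: \<pi>_def)
    qed
    ultimately show ?thesis by blast
  qed
qed

text \<open>The theorem without the tree: i stands for a node of height at most C/2, A i for the
  leaves below it, K for C^p and \<delta> for d^p. Sums run over indices, as distinct nodes may have
  the same leaves below them. The inequality for \<delta> bounds the cost of every sub-coupling;
  equality is needed only on pairs in a common A i, because the greedy coupling joins no
  others.\<close>

lemma least_partial_transport_cost_laminar:
  fixes A :: "'i \<Rightarrow> 'a set" and c :: "'i \<Rightarrow> real" and \<delta> :: "'a \<Rightarrow> 'a \<Rightarrow> real"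
    and \<mu> \<nu> :: "'a \<Rightarrow> real"
  assumes "finite X" and "finite I" and sub: "\<And>i. i \<in> I \<Longrightarrow> A i \<subseteq> X"
    and laminar: "\<And>i j. i \<in> I \<Longrightarrow> j \<in> I \<Longrightarrow> A i \<inter> A j = {} \<or> A i \<subseteq> A j \<or> A j \<subseteq> A i"
    and c_nonneg: "\<And>i. i \<in> I \<Longrightarrow> 0 \<le> c i"
    and point: "\<And>x. x \<in> X \<Longrightarrow> (\<Sum>i | i \<in> I \<and> x \<in> A i. c i) = K / 2"
    and \<delta>_ge: "\<And>x y. x \<in> X \<Longrightarrow> y \<in> X \<Longrightarrow>
      K - 2 * (\<Sum>i | i \<in> I \<and> x \<in> A i \<and> y \<in> A i. c i) \<le> \<delta> x y"
    and \<delta>_eq: "\<And>x y i. i \<in> I \<Longrightarrow> x \<in> A i \<Longrightarrow> y \<in> A i \<Longrightarrow>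
      \<delta> x y = K - 2 * (\<Sum>i | i \<in> I \<and> x \<in> A i \<and> y \<in> A i. c i)"
    and \<mu>: "\<mu> \<in> nonneg_measures X" and \<nu>: "\<nu> \<in> nonneg_measures X"
  defines "cost \<equiv> \<lambda>\<pi>. (\<Sum>(x, y)\<in>X \<times> X. \<delta> x y * \<pi> (x, y)) +
    K * ((total_mass X \<mu> + total_mass X \<nu>) / 2 - total_mass (X \<times> X) \<pi>)"
  shows "(LEAST v. v \<in> cost ` sub_couplings X \<mu> \<nu>) = (\<Sum>i\<in>I. c i * \<bar>sum \<mu> (A i) - sum \<nu> (A i)\<bar>)"
proof -
  define \<sigma> where "\<sigma> x y = (\<Sum>i | i \<in> I \<and> x \<in> A i \<and> y \<in> A i. c i)" for x y
  \<comment> \<open>By \<open>low_eq\<close> below, this is the cost with \<delta> replaced by K - 2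
    \<sigma>.\<close>
  define low where "low \<pi> = (\<Sum>i\<in>I. c i * (sum \<mu> (A i) + sum \<nu> (A i) - 2 * sum \<pi> (A i \<times> A i)))"
    for \<pi> :: "'a \<times> 'a \<Rightarrow> real"
  \<comment> \<open>After exchanging the sums, each point carries the total weight K / 2 of the sets
    around it.\<close>
  have swap1: "(\<Sum>i\<in>I. c i * sum f (A i)) = K / 2 * total_mass X f" for f :: "'a \<Rightarrow> real"
  proof -
    have "(\<Sum>i\<in>I. c i * sum f (A i)) = (\<Sum>i\<in>I. \<Sum>x\<in>X. if x \<in> A i then c i * f x else 0)"
      using sub \<open>finite X\<close>
      by (intro sum.cong refl)
        (simp add: sum_distrib_left sum.inter_restrict[symmetric] Int_absorb1)
    also have "\<dots> = (\<Sum>x\<in>X. (\<Sum>i | i \<in> I \<and> x \<in> A i. c i) * f x)"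
      using \<open>finite I\<close>
      by (subst sum.swap) (auto simp: sum.inter_filter sum_distrib_right intro!: sum.cong)
    also have "\<dots> = K / 2 * total_mass X f"
      by (simp add: point total_mass_def sum_distrib_left)
    finally show ?thesis .
  qed
  have swap2: "(\<Sum>i\<in>I. c i * sum \<pi> (A i \<times> A i)) = (\<Sum>(x, y)\<in>X \<times> X. \<sigma> x y * \<pi> (x, y))"
    for \<pi> :: "'a \<times> 'a \<Rightarrow> real"
  proof -
    have "(\<Sum>i\<in>I. c i * sum \<pi> (A i \<times> A i)) =
        (\<Sum>i\<in>I. \<Sum>z\<in>X \<times> X. if z \<in> A i \<times> A i then c i * \<pi> z else 0)"
      using sub \<open>finite X\<close>
      by (intro sum.cong refl, subst sum.inter_restrict[symmetric])
        (auto simp: sum_distrib_left Int_absorb1 Sigma_mono)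
    also have "\<dots> = (\<Sum>z\<in>X \<times> X. (\<Sum>i | i \<in> I \<and> z \<in> A i \<times> A i. c i) * \<pi> z)"
      using \<open>finite I\<close>
      by (subst sum.swap) (auto simp: sum.inter_filter sum_distrib_right intro!: sum.cong)
    also have "\<dots> = (\<Sum>(x, y)\<in>X \<times> X. \<sigma> x y * \<pi> (x, y))"
      by (intro sum.cong) (auto simp: \<sigma>_def)
    finally show ?thesis .
  qed
  have low_eq: "low \<pi> = (\<Sum>(x, y)\<in>X \<times> X. (K - 2 * \<sigma> x y) * \<pi> (x, y)) +
      K * ((total_mass X \<mu> + total_mass X \<nu>) / 2 - total_mass (X \<times> X) \<pi>)" for \<pi>
  proof -
    have "low \<pi> = (\<Sum>i\<in>I. c i * sum \<mu> (A i)) + (\<Sum>i\<in>I. c i * sum \<nu> (A i))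
        - 2 * (\<Sum>i\<in>I. c i * sum \<pi> (A i \<times> A i))"
      by (simp add: low_def algebra_simps sum.distrib sum_subtractf sum_distrib_left)
    moreover have "(\<Sum>(x, y)\<in>X \<times> X. (K - 2 * \<sigma> x y) * \<pi> (x, y)) =
        K * total_mass (X \<times> X) \<pi> - 2 * (\<Sum>(x, y)\<in>X \<times> X. \<sigma> x y * \<pi> (x, y))"
      by (simp add: total_mass_def algebra_simps sum_subtractf sum_distrib_left case_prod_unfold)
    ultimately show ?thesis
      unfolding swap1 swap2 by (simp add: right_diff_distrib distrib_left add_divide_distrib)
  qed
  let ?rhs = "\<Sum>i\<in>I. c i * \<bar>sum \<mu> (A i) - sum \<nu> (A i)\<bar>"
  have lower: "?rhs \<le> cost \<pi>" if \<pi>: "\<pi> \<in> sub_couplings X \<mu> \<nu>" for \<pi>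
  proof -
    have "?rhs \<le> low \<pi>"
      unfolding low_def
    proof (intro sum_mono mult_left_mono)
      \<comment> \<open>The transported mass is at most the minimum, and a + b - 2 min a b = |a -
        b|.\<close>
      fix i assume "i \<in> I"
      then show "\<bar>sum \<mu> (A i) - sum \<nu> (A i)\<bar> \<le> sum \<mu> (A i) + sum \<nu> (A i) - 2 * sum \<pi> (A i \<times> A i)"
        using sub_coupling_square_le_min[OF \<pi> \<open>finite X\<close> sub] by fastforce
    qed (use c_nonneg in auto)
    also have "low \<pi> \<le> cost \<pi>"
      unfolding low_eq cost_def using \<delta>_ge sub_couplings_nonneg[OF \<pi>]
      by (auto intro!: sum_mono mult_right_mono simp: \<sigma>_def)
    finally show ?thesis .
  qed
  obtain \<pi> where \<pi>: "\<pi> \<in> sub_couplings X \<mu> \<nu>"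
    and ge: "\<And>i. i \<in> I \<Longrightarrow> min (sum \<mu> (A i)) (sum \<nu> (A i)) \<le> sum \<pi> (A i \<times> A i)"
    and supp: "\<And>x y. \<pi> (x, y) \<noteq> 0 \<Longrightarrow> \<exists>i\<in>I. x \<in> A i \<and> y \<in> A i"
  proof -
    have "\<exists>\<pi>\<in>sub_couplings X \<mu> \<nu>.
      (\<forall>W\<in>A ` I. min (sum \<mu> W) (sum \<nu> W) \<le> sum \<pi> (W \<times> W)) \<and>
      (\<forall>x y. \<pi> (x, y) \<noteq> 0 \<longrightarrow> (\<exists>W\<in>A ` I. x \<in> W \<and> y \<in> W))"
    proof (rule laminar_coupling_ge)
      show "W \<inter> W' = {} \<or> W \<subseteq> W' \<or> W' \<subseteq> W" if "W \<in> A ` I" "W' \<in> A ` I" for W W'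
        using that laminar by (elim imageE) simp
    qed (use \<open>finite X\<close> sub \<mu> \<nu> in \<open>auto simp: nonneg_measures_def\<close>)
    then obtain \<pi> where \<pi>: "\<pi> \<in> sub_couplings X \<mu> \<nu>"
      "(\<forall>W\<in>A ` I. min (sum \<mu> W) (sum \<nu> W) \<le> sum \<pi> (W \<times> W)) \<and>
       (\<forall>x y. \<pi> (x, y) \<noteq> 0 \<longrightarrow> (\<exists>W\<in>A ` I. x \<in> W \<and> y \<in> W))"
      by (rule bexE)
    show ?thesis by (rule that[OF \<pi>(1)]) (use \<pi>(2) in simp_all)
  qed
  \<comment> \<open>Where \<pi> vanishes so do both integrands; elsewhere the two points share some
    A i, and the equality for \<delta> applies.\<close>
  have "cost \<pi> = low \<pi>"
    unfolding low_eq cost_def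
  proof (intro arg_cong2[where f = "(+)"] sum.cong refl)
    fix z
    have "\<delta> x y * \<pi> (x, y) = (K - 2 * \<sigma> x y) * \<pi> (x, y)" for x y
    proof (cases "\<pi> (x, y) = 0")
      case False
      then obtain i where "i \<in> I" "x \<in> A i" "y \<in> A i" using supp by metis
      then show ?thesis using \<delta>_eq by (simp add: \<sigma>_def)
    qed simp
    then show "(case z of (x, y) \<Rightarrow> \<delta> x y * \<pi> (x, y)) = (case z of (x, y) \<Rightarrow> (K - 2 * \<sigma> x y) * \<pi> (x, y))"
      by (cases z) (simp only: prod.case)
  qed
  also have "low \<pi> = ?rhs"
    unfolding low_def
  proof (intro sum.cong refl arg_cong2[where f = "(*)"])
    fix i assume i: "i \<in> I"
    \<comment> \<open>The greedy lower bound meets the upper bound valid for all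
      sub-couplings.\<close>
    have "sum \<pi> (A i \<times> A i) = min (sum \<mu> (A i)) (sum \<nu> (A i))"
      using ge[OF i] sub_coupling_square_le_min[OF \<pi> \<open>finite X\<close> sub[OF i]] by simp
    then show "sum \<mu> (A i) + sum \<nu> (A i) - 2 * sum \<pi> (A i \<times> A i) = \<bar>sum \<mu> (A i) - sum \<nu> (A i)\<bar>"
      by simp
  qed
  finally have attained: "cost \<pi> = ?rhs" .
  show ?thesis
  proof (rule Least_equality)
    show "?rhs \<in> cost ` sub_couplings X \<mu> \<nu>"
      unfolding attained[symmetric] using \<pi> by (rule imageI)
  qed (use lower in auto)
qed

section \<open>Ancestors and paths in a rooted tree\<close>

context weighted_rooted_tree
begin

lemma apath_tree_path: "u \<in> pverts T \<Longrightarrow> v \<in> pverts T \<Longrightarrow> apath u (tree_path T u v) v"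
  unfolding tree_path_def by (rule theI') (rule unique_path)

lemma apath_verts: "apath u q v \<Longrightarrow> u \<in> pverts T \<and> v \<in> pverts T"
  unfolding apath_def using awalk_hd_in_verts awalk_last_in_verts by blast

lemma tree_path_eqI:
  assumes "apath u q v" shows "tree_path T u v = q"
proof -
  have "u \<in> pverts T" "v \<in> pverts T" using apath_verts[OF assms] by auto
  with assms show ?thesis
    using unique_path[of u v] apath_tree_path[of u v] by blast
qed

lemma path_nodes_eq: "path_nodes T u v = set (awalk_verts u (tree_path T u v))"
  by (simp add: path_nodes_def)

lemma tree_dist_eqI: "apath u q v \<Longrightarrow> tree_dist T wt u v = awalk_cost wt q"
  by (simp add: tree_dist_def tree_path_eqI)

text \<open>Were v on the root path of u, the rest of that path from v on would be the root path of
  v. By the length hypothesis nothing precedes it, so u = v and the arc is a loop.\<close>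

lemma root_path_Cons:
  assumes "(v, u) \<in> parcs T"
    and len: "length (tree_path T u r) \<le> length (tree_path T v r)"
  shows "tree_path T v r = (v, u) # tree_path T u r"
proof (rule tree_path_eqI)
  have vu: "v \<in> pverts T" "u \<in> pverts T" "v \<noteq> u"
    using assms in_arcsD1 in_arcsD2 no_loops' by blast+
  have u: "apath u (tree_path T u r) r" using vu root_in_verts apath_tree_path by blast
  have "v \<notin> set (awalk_verts u (tree_path T u r))"
  proof
    assume "v \<in> set (awalk_verts u (tree_path T u r))"
    then obtain q s where qs: "tree_path T u r = q @ s" "awalk u q v" "awalk v s r"
      using u awalk_decomp unfolding apath_def by metis
    have "apath v s r"
      using u qs unfolding apath_append_iff qs(1) by (auto simp: awlast_of_awalk)
    then have "tree_path T v r = s" by (rule tree_path_eqI)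
    with len qs(1) have "q = []" by simp
    with qs(2) \<open>v \<noteq> u\<close> show False by (simp add: awalk_Nil_iff)
  qed
  with u assms(1) show "apath v ((v, u) # tree_path T u r) r" by (simp add: apath_Cons_iff)
qed

lemma tree_path_root [simp]: "tree_path T r r = []"
  by (rule tree_path_eqI) (simp add: apath_Nil_iff root_in_verts)

text \<open>This gives meaning to the description operator in \<open>parent\<close>: the head of the
  first arc of the root path qualifies, and by \<open>root_path_Cons\<close> every other candidate
  starts the same path.\<close>

lemma root_path_step:
  assumes "v \<in> pverts T" and "v \<noteq> r"
  shows "(v, parent T r v) \<in> parcs T"
    and "tree_path T v r = (v, parent T r v) # tree_path T (parent T r v) r"
proof -
  have ap: "apath v (tree_path T v r) r" using assms root_in_verts apath_tree_path by blast
  with \<open>v \<noteq> r\<close> obtain e q where eq: "tree_path T v r = e # q"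
    by (cases "tree_path T v r") (auto simp: apath_Nil_iff)
  define u where "u = snd e"
  have e: "e = (v, u)" "(v, u) \<in> parcs T" "apath u q r"
    using ap unfolding eq apath_Cons_iff u_def by (cases e; auto)+
  have q: "q = tree_path T u r" using tree_path_eqI[OF e(3)] by simp
  have "(THE w. (v, w) \<in> parcs T \<and> length (tree_path T w r) < length (tree_path T v r)) = u"
  proof (rule the_equality)
    show "(v, u) \<in> parcs T \<and> length (tree_path T u r) < length (tree_path T v r)"
      using e q eq by simp
    fix w assume "(v, w) \<in> parcs T \<and> length (tree_path T w r) < length (tree_path T v r)"
    then have "tree_path T v r = (v, w) # tree_path T w r" by (intro root_path_Cons) auto
    with eq e show "w = u" by simp
  qed
  then have "parent T r v = u" using \<open>v \<noteq> r\<close> by (simp add: parent_def)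
  then show "(v, parent T r v) \<in> parcs T"
    and "tree_path T v r = (v, parent T r v) # tree_path T (parent T r v) r"
    using e q eq by simp_all
qed

lemma parent_root [simp]: "parent T r r = r"
  by (simp add: parent_def)

lemma parent_in_verts: "v \<in> pverts T \<Longrightarrow> parent T r v \<in> pverts T"
  by (cases "v = r") (use root_in_verts root_path_step(1) in_arcsD2 in auto)

text \<open>Induction on the number of edges to the root. Most facts about ancestors, heights and
  weights follow by climbing one edge with it.\<close>

lemma parent_induct [consumes 1, case_names root parent]:
  assumes "v \<in> pverts T" and "P r"
    and "\<And>v. v \<in> pverts T \<Longrightarrow> v \<noteq> r \<Longrightarrow> P (parent T r v) \<Longrightarrow> P v"
  shows "P v"
  using assms(1)
proof (induction "length (tree_path T v r)" arbitrary: v)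
  case 0
  then have "v = r" using root_path_step(2)[of v] by fastforce
  with \<open>P r\<close> show ?case by simp
next
  case (Suc n)
  then have "v \<noteq> r" by auto
  moreover have "P (parent T r v)"
    using Suc.hyps Suc.prems root_path_step(2)[OF _ \<open>v \<noteq> r\<close>] parent_in_verts by fastforce
  ultimately show ?case using assms(3) Suc.prems by blast
qed

lemma ancestors_root [simp]: "path_nodes T r r = {r}"
  by (simp add: path_nodes_eq)

lemma ancestors_step:
  "v \<in> pverts T \<Longrightarrow> v \<noteq> r \<Longrightarrow> path_nodes T v r = insert v (path_nodes T (parent T r v) r)"
  using root_path_step(2)[of v] by (simp add: path_nodes_eq)

lemma not_ancestor_parent: "v \<in> pverts T \<Longrightarrow> v \<noteq> r \<Longrightarrow> v \<notin> path_nodes T (parent T r v) r"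
  using root_path_step(2)[of v] apath_tree_path[of v r] root_in_verts
  by (simp add: path_nodes_eq apath_Cons_iff)

lemma parent_neq: "v \<in> pverts T \<Longrightarrow> v \<noteq> r \<Longrightarrow> parent T r v \<noteq> v"
  using root_path_step(1)[of v] no_loops' by fastforce

lemma ancestor_refl: "v \<in> pverts T \<Longrightarrow> v \<in> path_nodes T v r"
  by (cases "v = r") (simp_all add: ancestors_step)

text \<open>With \<open>w \<in> path_nodes T v r\<close> read as "w is an ancestor of v", this is
  transitivity; together with \<open>ancestor_refl\<close> and \<open>ancestor_antisym\<close> it
  yields a partial order on the nodes.\<close>

lemma ancestors_mono:
  assumes "v \<in> pverts T" and "w \<in> path_nodes T v r"
  shows "path_nodes T w r \<subseteq> path_nodes T v r"
  using assms
proof (induction rule: parent_induct)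
  case (parent v) then show ?case using ancestors_step[of v] by auto
qed simp

text \<open>The source of laminarity and of the uniqueness of cut nodes. Either one of v and w is x
  itself, and the other is its ancestor, or both are ancestors of the parent of x.\<close>

lemma ancestors_total:
  assumes "x \<in> pverts T" "v \<in> path_nodes T x r" "w \<in> path_nodes T x r"
  shows "v \<in> path_nodes T w r \<or> w \<in> path_nodes T v r"
  using assms
proof (induction rule: parent_induct)
  case (parent x) then show ?case using ancestors_step[of x] by auto
qed simp

text \<open>Otherwise v would be an ancestor of its own parent, and its root path would visit v
  twice.\<close>

lemma ancestor_antisym:
  assumes "v \<in> pverts T" "w \<in> path_nodes T v r" "v \<in> path_nodes T w r"
  shows "v = w"
proof (rule ccontr)
  assume "v \<noteq> w"
  with assms have "v \<noteq> r" by (cases "v = r") auto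
  with assms \<open>v \<noteq> w\<close> have "w \<in> path_nodes T (parent T r v) r"
    by (simp add: ancestors_step)
  then have "v \<in> path_nodes T (parent T r v) r"
    using ancestors_mono assms parent_in_verts by blast
  then show False using not_ancestor_parent \<open>v \<in> pverts T\<close> \<open>v \<noteq> r\<close> by blast
qed

lemma finite_children: "finite (children T r v)"
  using pair_finite_verts by (simp add: children_def)

lemma finite_leaves: "finite (leaves T)"
  using pair_finite_verts by (simp add: leaves_def)

end

section \<open>Heights, lowest common ancestors and the distance between leaves\<close>

context ultrametric_tree_height
begin

lemma height_ancestor:
  assumes "v \<in> pverts T" "w \<in> path_nodes T v r"
  shows "h v \<le> h w"
  using assms
proof (induction rule: parent_induct)
  case (parent v)
  then show ?case using ancestors_step[of v] height_parent[of v] by force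
qed simp

lemma weight_parent:
  assumes "v \<in> pverts T" "v \<noteq> r"
  shows "wt (v, parent T r v) = h (parent T r v) - h v"
proof -
  have "apath v [(v, parent T r v)] (parent T r v)"
    using root_path_step(1)[OF assms] parent_neq[OF assms, symmetric] parent_in_verts[OF assms(1)]
    by (simp add: apath_simps)
  then show ?thesis
    using tree_dist_eqI height_dist[of v] height_parent[of v] assms by fastforce
qed

text \<open>The vertex set is stated exactly so that the induction can see that y is new when the
  arc from its parent is appended. The weights telescope.\<close>

lemma downward_apath:
  assumes "y \<in> pverts T" "x \<in> path_nodes T y r"
  shows "\<exists>q. apath x q y \<and> awalk_cost wt q = h x - h y \<and>
    set (awalk_verts x q) = insert x (path_nodes T y r - path_nodes T x r)"
  using assms
proof (induction rule: parent_induct)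
  case root
  then show ?case by (intro exI[of _ "[]"]) (auto simp: apath_Nil_iff root_in_verts)
next
  case (parent y)
  show ?case
  proof (cases "x = y")
    case True
    then show ?thesis using parent
      by (intro exI[of _ "[]"]) (auto simp: apath_Nil_iff)
  next
    case False
    let ?u = "parent T r y"
    have x: "x \<in> path_nodes T ?u r" using False parent by (simp add: ancestors_step)
    then obtain q where q: "apath x q ?u" "awalk_cost wt q = h x - h ?u"
      "set (awalk_verts x q) = insert x (path_nodes T ?u r - path_nodes T x r)"
      using parent by blast
    have arc: "(?u, y) \<in> parcs T" using root_path_step(1) parent arcs_symmetric by blast
    have u: "?u \<in> pverts T" using parent parent_in_verts by blast
    have y: "y \<notin> path_nodes T ?u r" using not_ancestor_parent parent by blast
    then have y': "y \<notin> path_nodes T x r" using ancestors_mono[OF u x] by blast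
    have walk: "awalk x q ?u" "awalk ?u [(?u, y)] y"
      using q(1) arc parent(1) by (auto simp: apath_def awalk_simps)
    have last: "last (pawalk_verts x q) = ?u" by (rule awalkE[OF walk(1)])
    have "apath x (q @ [(?u, y)]) y"
      unfolding apath_append_iff last
      using q arc parent(1) y x parent_neq[OF parent(1,2)] False by (auto simp: apath_simps)
    \<comment> \<open>The arc is traversed downward, whereas \<open>weight_parent\<close> concerns
      the upward one; \<open>weight_sym\<close> links them.\<close>
    moreover have "awalk_cost wt (q @ [(?u, y)]) = h x - h y"
      using q weight_parent[OF parent(1,2)] weight_sym[OF arc] by simp
    moreover have "set (awalk_verts x (q @ [(?u, y)])) = insert x (path_nodes T y r - path_nodes T x r)"
      unfolding set_awalk_verts_append[OF walk]
      using q(3) walk y y' x u ancestor_refl[OF u] ancestor_antisym[OF u x]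
      by (auto simp: ancestors_step[OF parent(1,2)])
    ultimately show ?thesis by blast
  qed
qed

text \<open>z is the lowest common ancestor, described through its ancestor set. The path climbs
  from x to the first ancestor of y, which is z, and descends from there. The bound on its vertices
  keeps x off the rest of the path when the upward arc from x is prepended.\<close>

lemma ex_meet_apath:
  assumes "x \<in> pverts T" "y \<in> pverts T"
  shows "\<exists>z q. z \<in> pverts T \<and> path_nodes T x r \<inter> path_nodes T y r = path_nodes T z r \<and>
    apath x q y \<and> awalk_cost wt q = 2 * h z - h x - h y \<and>
    set (awalk_verts x q) \<subseteq> path_nodes T x r \<union> path_nodes T y r" (is "?P x")
proof -
  have anc: "?P x" if x: "x \<in> pverts T" "x \<in> path_nodes T y r" for x
  proof -
    obtain q where "apath x q y" "awalk_cost wt q = h x - h y"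
      "set (awalk_verts x q) = insert x (path_nodes T y r - path_nodes T x r)"
      using downward_apath x assms by blast
    then show ?thesis
      using x ancestors_mono[OF assms(2) x(2)] by (intro exI[of _ x] exI[of _ q]) auto
  qed
  show ?thesis
    using assms(1)
  proof (induction rule: parent_induct)
    case root
    have "r \<in> path_nodes T y r" using assms(2)
      by (induction rule: parent_induct) (simp_all add: ancestors_step)
    then show ?case using anc root_in_verts by blast
  next
    case (parent x)
    show ?case
    proof (cases "x \<in> path_nodes T y r")
      case True then show ?thesis using anc parent by blast
    next
      case False
      let ?u = "parent T r x"
      obtain z q where zq: "z \<in> pverts T" "path_nodes T ?u r \<inter> path_nodes T y r = path_nodes T z r"
        "apath ?u q y" "awalk_cost wt q = 2 * h z - h ?u - h y"
        "set (awalk_verts ?u q) \<subseteq> path_nodes T ?u r \<union> path_nodes T y r"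
        using parent by blast
      have "apath x ((x, ?u) # q) y"
        using zq False not_ancestor_parent[OF parent(1,2)] root_path_step(1)[OF parent(1,2)]
        by (auto simp: apath_Cons_iff)
      moreover have "awalk_cost wt ((x, ?u) # q) = 2 * h z - h x - h y"
        using zq weight_parent[OF parent(1,2)] by simp
      ultimately show ?thesis
        using zq False
        by (intro exI[of _ z] exI[of _ "(x, ?u) # q"]) (auto simp: ancestors_step[OF parent(1,2)])
    qed
  qed
qed

lemma ex_meet:
  assumes "x \<in> leaves T" "y \<in> leaves T"
  obtains z where "z \<in> pverts T" "path_nodes T x r \<inter> path_nodes T y r = path_nodes T z r"
    "tree_dist T wt x y = 2 * h z"
proof -
  have "x \<in> pverts T" "y \<in> pverts T" using assms by (auto simp: leaves_def)
  then show ?thesis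
    using that ex_meet_apath[of x y] tree_dist_eqI height_leaf assms by fastforce
qed

section \<open>The cut at height C/2\<close>

lemma height_le_root: "v \<in> pverts T \<Longrightarrow> h v \<le> h r"
proof (induction rule: parent_induct)
  case (parent v)
  then show ?case using height_parent[of v] by simp
qed simp

text \<open>As the root is its own parent, a root of height at most C/2 fails the strict inequality.
  The convention for this case becomes the alternative \<open>v = r\<close>, which is void for a
  higher root.\<close>

lemma cut_nodes_eq:
  "cut_nodes T r h C = {v \<in> pverts T. h v \<le> C / 2 \<and> (v = r \<or> C / 2 < h (parent T r v))}"
proof (cases "h r \<le> C / 2")
  case True
  have "h (parent T r v) \<le> C / 2" if "v \<in> pverts T" for v
    using True height_le_root[OF parent_in_verts[OF that]] by simp
  then show ?thesis using True root_in_verts by (fastforce simp: cut_nodes_def)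
next
  case False
  then show ?thesis by (auto simp: cut_nodes_def)
qed

text \<open>Climbing from x, the last node before the height exceeds C/2 is a cut node, or else the
  root is.\<close>

lemma ex_cut_ancestor:
  assumes "x \<in> pverts T" "h x \<le> C / 2"
  shows "\<exists>v\<in>cut_nodes T r h C. v \<in> path_nodes T x r"
  using assms
proof (induction rule: parent_induct)
  case root
  then show ?case by (auto simp: cut_nodes_eq root_in_verts)
next
  case (parent x)
  then show ?case
    by (cases "h (parent T r x) \<le> C / 2") (auto simp: ancestors_step cut_nodes_eq)
qed

text \<open>A proper ancestor of v' is at least as high as the parent of v', which is higher than
  C/2.\<close>

lemma cut_nodes_antichain:
  assumes "v \<in> cut_nodes T r h C" "v' \<in> cut_nodes T r h C" "v \<in> path_nodes T v' r"
  shows "v = v'"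
proof (rule ccontr)
  assume "v \<noteq> v'"
  have v': "v' \<in> pverts T" using assms by (simp add: cut_nodes_eq)
  have "v' \<noteq> r" using assms \<open>v \<noteq> v'\<close> by auto
  then have "v \<in> path_nodes T (parent T r v') r"
    using assms \<open>v \<noteq> v'\<close> v' by (simp add: ancestors_step)
  then have "h (parent T r v') \<le> h v" using height_ancestor parent_in_verts v' by blast
  then show False using assms \<open>v' \<noteq> r\<close> by (auto simp: cut_nodes_eq)
qed

lemma cut_ancestor_unique:
  assumes "x \<in> pverts T" "v \<in> cut_nodes T r h C" "v \<in> path_nodes T x r"
    and "v' \<in> cut_nodes T r h C" "v' \<in> path_nodes T x r"
  shows "v = v'"
  using ancestors_total[OF assms(1,3,5)] cut_nodes_antichain assms(2,4) by blast

lemma Union_children_cut_nodes: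
  "(\<Union>v\<in>cut_nodes T r h C. children T r v) = {x \<in> pverts T. h x \<le> C / 2}"
proof -
  have "h w \<le> C / 2" if "v \<in> cut_nodes T r h C" "w \<in> children T r v" for v w
    using that height_ancestor[of w v] by (auto simp: cut_nodes_eq children_def)
  then show ?thesis using ex_cut_ancestor by (fastforce simp: children_def)
qed

text \<open>Weights for which the total weight above a leaf, up to its cut node, is half the maximal
  cost. A cut node gets what is missing after the edges below it have been counted.\<close>

definition cut_weight :: "real \<Rightarrow> real \<Rightarrow> 'a \<Rightarrow> real" where
  "cut_weight p C w = (if w \<in> cut_nodes T r h C then C powr p / 2 - 2 powr (p - 1) * h w powr p
     else 2 powr (p - 1) * (h (parent T r w) powr p - h w powr p))"

text \<open>At a cut node h w \<le> C/2, and 2^(p-1) (C/2)^p = C^p/2; elsewhere the parent is at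
  least as high.\<close>

lemma cut_weight_nonneg:
  assumes "1 \<le> p" "0 < C" "w \<in> pverts T"
  shows "0 \<le> cut_weight p C w"
proof (cases "w \<in> cut_nodes T r h C")
  case True
  then have "h w powr p \<le> (C / 2) powr p"
    using assms height_nonneg by (intro powr_mono2) (auto simp: cut_nodes_eq)
  then have "2 powr (p - 1) * h w powr p \<le> 2 powr (p - 1) * (C / 2) powr p" by simp
  also have "\<dots> = C powr p / 2"
    using assms by (simp add: powr_divide powr_diff)
  finally show ?thesis using True by (simp add: cut_weight_def)
next
  case False
  then show ?thesis
    using assms height_nonneg height_parent by (simp add: cut_weight_def powr_mono2)
qed

text \<open>The weights telescope up to the cut node. At a leaf the value is C^p/2; at the meet z of
  two leaves, C^p minus twice the value is 2^p h(z)^p, which is d^p.\<close>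

lemma sum_cut_weight_ancestors:
  assumes "x \<in> pverts T" "h x \<le> C / 2"
  shows "(\<Sum>w | (w \<in> pverts T \<and> h w \<le> C / 2) \<and> w \<in> path_nodes T x r. cut_weight p C w) =
    C powr p / 2 - 2 powr (p - 1) * h x powr p"
proof -
  define S where "S x = {w. (w \<in> pverts T \<and> h w \<le> C / 2) \<and> w \<in> path_nodes T x r}" for x
  have fin: "finite (S x)" for x
    using pair_finite_verts by (simp add: S_def)
  have "sum (cut_weight p C) (S x) = C powr p / 2 - 2 powr (p - 1) * h x powr p"
    using assms
  proof (induction rule: parent_induct)
    case root
    then have "S r = {r}" by (auto simp: S_def root_in_verts)
    with root show ?case by (simp add: cut_weight_def cut_nodes_eq root_in_verts)
  next
    case (parent x)
    show ?case
    proof (cases "x \<in> cut_nodes T r h C")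
      case True
      have "S x = {x}"
      proof (intro equalityI subsetI)
        fix w assume "w \<in> S x"
        moreover have "C / 2 < h w" if "w \<in> path_nodes T (parent T r x) r"
          using that height_ancestor[OF parent_in_verts[OF parent(1)] that] True parent(2)
          by (auto simp: cut_nodes_eq)
        ultimately show "w \<in> {x}" using parent by (auto simp: S_def ancestors_step)
      qed (use parent in \<open>auto simp: S_def ancestors_step\<close>)
      with True show ?thesis by (simp add: cut_weight_def)
    next
      case False
      then have "h (parent T r x) \<le> C / 2" using parent by (auto simp: cut_nodes_eq)
      moreover have "S x = insert x (S (parent T r x))"
        using parent by (auto simp: S_def ancestors_step)
      moreover have "x \<notin> S (parent T r x)"
        using not_ancestor_parent parent by (auto simp: S_def)
      ultimately show ?thesis
        using False parent fin by (simp add: cut_weight_def algebra_simps)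
    qed
  qed
  then show ?thesis by (simp add: S_def)
qed

text \<open>The subtrees of the cut nodes partition the nodes of height at most C/2, and each
  contains one cut node only, its top. So the two cases of \<open>cut_weight\<close> are the two
  summands.\<close>

lemma sum_cut_nodes_eq:
  "(\<Sum>v\<in>cut_nodes T r h C.
      2 powr (p - 1) *
        (\<Sum>w\<in>children T r v - {v}. (h (parent T r w) powr p - h w powr p) * D w)
      + (C powr p / 2 - 2 powr (p - 1) * h v powr p) * D v) =
    (\<Sum>w\<in>{x \<in> pverts T. h x \<le> C / 2}. cut_weight p C w * D w)" (is "?L = _")
proof -
  have fin: "finite (cut_nodes T r h C)"
    using pair_finite_verts by (simp add: cut_nodes_eq)
  have "?L = (\<Sum>v\<in>cut_nodes T r h C. \<Sum>w\<in>children T r v. cut_weight p C w * D w)"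
  proof (intro sum.cong refl)
    fix v assume v: "v \<in> cut_nodes T r h C"
    have vv: "v \<in> children T r v" using v ancestor_refl by (simp add: cut_nodes_eq children_def)
    have "w \<notin> cut_nodes T r h C" if "w \<in> children T r v - {v}" for w
      using cut_nodes_antichain[OF v, of w] that by (auto simp: children_def)
    then have "(\<Sum>w\<in>children T r v - {v}. cut_weight p C w * D w) =
        2 powr (p - 1) * (\<Sum>w\<in>children T r v - {v}. (h (parent T r w) powr p - h w powr p) * D w)"
      by (simp add: cut_weight_def sum_distrib_left mult.assoc)
    then show "2 powr (p - 1) *
        (\<Sum>w\<in>children T r v - {v}. (h (parent T r w) powr p - h w powr p) * D w)
      + (C powr p / 2 - 2 powr (p - 1) * h v powr p) * D v =
      (\<Sum>w\<in>children T r v. cut_weight p C w * D w)"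
      using v by (simp add: sum.remove[OF finite_children vv] cut_weight_def)
  qed
  also have "\<dots> = (\<Sum>w\<in>(\<Union>v\<in>cut_nodes T r h C. children T r v). cut_weight p C w * D w)"
    using fin finite_children cut_ancestor_unique
    by (intro sum.UNION_disjoint[symmetric]) (auto simp: children_def)
  finally show ?thesis by (simp only: Union_children_cut_nodes)
qed

lemma least_KR_cost_leaves:
  assumes p: "1 \<le> p" and C: "0 < C"
    and "\<mu> \<in> nonneg_measures (leaves T)" "\<nu> \<in> nonneg_measures (leaves T)"
  shows "(LEAST c. c \<in> KR_cost p C (leaves T) (tree_dist T wt) \<mu> \<nu> ` sub_couplings (leaves T) \<mu> \<nu>) =
    (\<Sum>w\<in>{x \<in> pverts T. h x \<le> C / 2}.
      cut_weight p C w * \<bar>subtree_mass T r \<mu> w - subtree_mass T r \<nu> w\<bar>)"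
  unfolding KR_cost_def subtree_mass_def
proof (rule least_partial_transport_cost_laminar)
  let ?U = "{x \<in> pverts T. h x \<le> C / 2}" and ?A = "\<lambda>w. children T r w \<inter> leaves T"
  have leaf: "x \<in> pverts T" "h x = 0" if "x \<in> leaves T" for x
    using that height_leaf by (auto simp: leaves_def)
  have two: "2 powr p = 2 * 2 powr (p - 1)" by (simp add: powr_diff)
  show "finite (leaves T)" by (rule finite_leaves)
  show "finite ?U" using pair_finite_verts by simp
  show "?A w \<subseteq> leaves T" for w by blast
  show "?A v \<inter> ?A w = {} \<or> ?A v \<subseteq> ?A w \<or> ?A w \<subseteq> ?A v" for v w
  proof (cases "?A v \<inter> ?A w = {}")
    case False
    then obtain x where "x \<in> pverts T" "v \<in> path_nodes T x r" "w \<in> path_nodes T x r"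
      by (auto simp: children_def)
    then have "v \<in> path_nodes T w r \<or> w \<in> path_nodes T v r" by (rule ancestors_total)
    then show ?thesis using ancestors_mono by (fastforce simp: children_def)
  qed simp
  show "0 \<le> cut_weight p C w" if "w \<in> ?U" for w
    using cut_weight_nonneg p C that by simp
  show "(\<Sum>w | w \<in> ?U \<and> x \<in> ?A w. cut_weight p C w) = C powr p / 2" if x: "x \<in> leaves T" for x
  proof -
    have "{w. w \<in> ?U \<and> x \<in> ?A w} =
        {w. (w \<in> pverts T \<and> h w \<le> C / 2) \<and> w \<in> path_nodes T x r}"
      using leaf[OF x] x by (auto simp: children_def)
    then show ?thesis
      using sum_cut_weight_ancestors[of x C p] leaf[OF x] C by simp
  qed
  \<comment> \<open>The common ancestors of two leaves are the ancestors of their meet z, so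
    \<open>sum_cut_weight_ancestors\<close> at z evaluates the sum over common ancestors.\<close>
  have key: "\<exists>z\<in>pverts T. {w. w \<in> ?U \<and> x \<in> ?A w \<and> y \<in> ?A w} =
        {w. (w \<in> pverts T \<and> h w \<le> C / 2) \<and> w \<in> path_nodes T z r} \<and>
      tree_dist T wt x y powr p = 2 * 2 powr (p - 1) * h z powr p"
    if xy: "x \<in> leaves T" "y \<in> leaves T" for x y
  proof -
    obtain z where z: "z \<in> pverts T" "path_nodes T x r \<inter> path_nodes T y r = path_nodes T z r"
      "tree_dist T wt x y = 2 * h z"
      using ex_meet[OF xy] by blast
    have "{w. w \<in> ?U \<and> x \<in> ?A w \<and> y \<in> ?A w} =
        {w. (w \<in> pverts T \<and> h w \<le> C / 2) \<and> w \<in> path_nodes T z r}"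
      unfolding z(2)[symmetric] using xy leaf by (auto simp: children_def)
    moreover have "tree_dist T wt x y powr p = 2 * 2 powr (p - 1) * h z powr p"
      using height_nonneg[OF z(1)] by (simp add: z(3) powr_mult two)
    ultimately show ?thesis using z(1) by blast
  qed
  show "C powr p - 2 * (\<Sum>w | w \<in> ?U \<and> x \<in> ?A w \<and> y \<in> ?A w. cut_weight p C w)
      \<le> tree_dist T wt x y powr p" if xy: "x \<in> leaves T" "y \<in> leaves T" for x y
  proof -
    obtain z where z: "z \<in> pverts T"
      "{w. w \<in> ?U \<and> x \<in> ?A w \<and> y \<in> ?A w} =
        {w. (w \<in> pverts T \<and> h w \<le> C / 2) \<and> w \<in> path_nodes T z r}"
      "tree_dist T wt x y powr p = 2 * 2 powr (p - 1) * h z powr p"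
      using key[OF xy] by blast
    show ?thesis
    \<comment> \<open>A meet of height at most C/2 gives equality. Above a higher one the sum is
      empty, and the claim is C^p \<le> (2 h(z))^p.\<close>
    proof (cases "h z \<le> C / 2")
      case True
      then show ?thesis
        unfolding z(2,3) sum_cut_weight_ancestors[OF z(1) True] by simp
    next
      case False
      then have none: "{w. (w \<in> pverts T \<and> h w \<le> C / 2) \<and> w \<in> path_nodes T z r} = {}"
        using height_ancestor[OF z(1)] by force
      have "(C / 2) powr p \<le> h z powr p"
        using False p C by (intro powr_mono2) auto
      then have "C powr p \<le> 2 powr p * h z powr p"
        using C by (simp add: powr_divide field_simps)
      then show ?thesis unfolding z(2,3) none by (simp add: two)
    qed
  qed
  show "tree_dist T wt x y powr p =
      C powr p - 2 * (\<Sum>w | w \<in> ?U \<and> x \<in> ?A w \<and> y \<in> ?A w. cut_weight p C w)"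
    if w: "w \<in> ?U" "x \<in> ?A w" "y \<in> ?A w" for x y w
  proof -
    have xy: "x \<in> leaves T" "y \<in> leaves T" using w by auto
    obtain z where z: "z \<in> pverts T"
      "{w. w \<in> ?U \<and> x \<in> ?A w \<and> y \<in> ?A w} =
        {w. (w \<in> pverts T \<and> h w \<le> C / 2) \<and> w \<in> path_nodes T z r}"
      "tree_dist T wt x y powr p = 2 * 2 powr (p - 1) * h z powr p"
      using key[OF xy] by blast
    \<comment> \<open>A common ancestor w of height at most C/2 lies above the meet, so z is at most
      that high too.\<close>
    have "w \<in> path_nodes T z r" using w z(2) by blast
    then have "h z \<le> C / 2" using height_ancestor[OF z(1)] w by force
    then show ?thesis
      unfolding z(2,3) sum_cut_weight_ancestors[OF z(1) \<open>h z \<le> C / 2\<close>] by simp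
  qed
qed fact+

end

theorem theorem2p3:
  fixes T :: "'a pair_pre_digraph" and wt :: "('a \<times> 'a) weight_fun" and r :: 'a
    and h :: "'a \<Rightarrow> real" and p C :: real and \<mu> \<nu> :: "'a \<Rightarrow> real"
  assumes "ultrametric_tree_height T wt r h"
    and "p \<ge> 1" and "C > 0"
    and "\<mu> \<in> nonneg_measures (leaves T)" and "\<nu> \<in> nonneg_measures (leaves T)"
  shows "KR p C (leaves T) (tree_dist T wt) \<mu> \<nu> powr p =
    (\<Sum>v\<in>cut_nodes T r h C.
       2 powr (p - 1) *
         (\<Sum>w\<in>children T r v - {v}.
            (h (parent T r w) powr p - h w powr p) *
            \<bar>subtree_mass T r \<mu> w - subtree_mass T r \<nu> w\<bar>)
       + (C powr p / 2 - 2 powr (p - 1) * h v powr p) *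
         \<bar>subtree_mass T r \<mu> v - subtree_mass T r \<nu> v\<bar>)"
proof -
  interpret ultrametric_tree_height T wt r h by fact
  \<comment> \<open>\<open>KR\<close> takes a p-th root; raising it to the power p returns the
    minimum because that is non-negative.\<close>
  have "0 \<le> (\<Sum>w\<in>{x \<in> pverts T. h x \<le> C / 2}.
      cut_weight p C w * \<bar>subtree_mass T r \<mu> w - subtree_mass T r \<nu> w\<bar>)"
    using assms by (intro sum_nonneg mult_nonneg_nonneg cut_weight_nonneg) auto
  then show ?thesis
    unfolding sum_cut_nodes_eq KR_def least_KR_cost_leaves[OF assms(2-5)]
    using \<open>p \<ge> 1\<close> by (simp add: powr_powr)
qed

end
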